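(* Let $(K,v)$ be a henselian valued field with value group $vK$. Suppose that $vK$ is not closed in its divisible hull $(vK)^{\mathrm{div}}$. Then $v$ is definable in the language of rings $\mathcal{L}_{\mathrm{r}}$ with one parameter from $K$; that is, there exist an $\mathcal{L}_{\mathrm{r}}$-formula $\varphi(x,y)$ and an element $c\in K$ such that $\mathcal{O}_v=\{a\in K\mid K\models\varphi(a,c)\}$.
   Context: Valuations are Krull valuations, written additively. For a valued field $(K,v)$, $vK$ denotes the value group (an ordered, i.e. totally ordered, abelian group), and $\mathcal{O}_v=\{a\in K\mid v(a)\ge 0\}$ the valuation ring. The language of rings is $\mathcal{L}_{\mathrm{r}}=\{+,-,\cdot,0,1\}$. For an ordered abelian group $G$, $G^{\mathrm{div}}$ denotes its divisible hull with the unique ordering extending that of $G$; "closed in $G^{\mathrm{div}}$" refers to the order topology on $G^{\mathrm{div}}$. *)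

theory Defs
  imports
    Complex_Main
    "HOL-Library.Extended"
    "HOL-Computational_Algebra.Polynomial"
begin

section \<open>Henselian valued fields\<close>

text \<open>
  A valuation takes the value \<open>Pinf\<close> exactly at 0 and never takes the value \<open>Minf\<close>.
  As \<open>v\<close> maps onto \<open>'g\<close> together with \<open>Pinf\<close>, the type \<open>'g\<close> is its value group.
\<close>

locale valued_field =
  fixes v :: "'k::field \<Rightarrow> 'g::linordered_ab_group_add extended"
  assumes v_eq_Pinf_iff: "v x = Pinf \<longleftrightarrow> x = 0"
    and v_mult: "v (x * y) = v x + v y"
    and v_add: "min (v x) (v y) \<le> v (x + y)"
    and range_v: "range v = insert Pinf (range Fin)"

definition valuation_ring :: "('k::field \<Rightarrow> 'g::linordered_ab_group_add extended) \<Rightarrow> 'k set"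
  where "valuation_ring v = {a. v a \<ge> 0}"

text \<open>
  Hensel's Lemma: every simple zero in the residue field of a polynomial over the valuation
  ring lifts to a zero. For \<open>a\<close> and \<open>f\<close> over the valuation ring, the residue of \<open>a\<close> is a simple
  zero of the residue of \<open>f\<close> iff \<open>v (poly f a) > 0\<close> and \<open>v (poly (pderiv f) a) = 0\<close>.
\<close>

locale henselian_valued_field = valued_field v
  for v :: "'k::field \<Rightarrow> 'g::linordered_ab_group_add extended" +
  assumes hensel:
    "\<lbrakk>\<forall>i. coeff f i \<in> valuation_ring v; a \<in> valuation_ring v;
      v (poly f a) > 0; v (poly (pderiv f) a) = 0\<rbrakk>
     \<Longrightarrow> \<exists>b\<in>valuation_ring v. poly f b = 0 \<and> v (b - a) > 0"


section \<open>The divisible hull of an ordered abelian group\<close>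

primrec nmult :: "nat \<Rightarrow> 'a::monoid_add \<Rightarrow> 'a"
  where
    "nmult 0 a = 0"
  | "nmult (Suc n) a = a + nmult n a"

lemma nmult_one [simp]: "nmult (Suc 0) a = a"
  by simp

lemma nmult_add_left: "nmult (m + n) a = nmult m a + nmult n a"
  by (induction m) (simp_all add: add.assoc)

lemma nmult_nmult: "nmult m (nmult n a) = nmult (m * n) a"
  by (induction m) (simp_all add: nmult_add_left)

lemma nmult_zero [simp]: "nmult n (0::'a::monoid_add) = 0"
  by (induction n) simp_all

lemma nmult_add: "nmult n (a + b) = nmult n a + nmult n (b::'a::comm_monoid_add)"
  by (induction n) (simp_all add: ac_simps)

lemma nmult_uminus: "nmult n (- a) = - nmult n (a::'a::ab_group_add)"
  by (induction n) simp_all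

lemma nmult_commute: "nmult m (nmult n a) = nmult n (nmult m a)"
  by (simp add: nmult_nmult mult.commute)

lemma nmult_strict_mono: "nmult n a < nmult n b"
  if "a < b" "0 < n" for a b :: "'a::linordered_ab_group_add"
proof -
  have "nmult (Suc k) a < nmult (Suc k) b" for k
    using that(1) by (induction k) (auto intro: add_strict_mono)
  then show ?thesis
    using that(2) by (cases n) auto
qed

lemma nmult_less_iff [simp]:
  "nmult n a < nmult n b \<longleftrightarrow> a < b" if "0 < n" for a b :: "'a::linordered_ab_group_add"
  using nmult_strict_mono [of a b n] nmult_strict_mono [of b a n] that
  by (cases a b rule: linorder_cases) auto

lemma nmult_le_iff [simp]:
  "nmult n a \<le> nmult n b \<longleftrightarrow> a \<le> b" if "0 < n" for a b :: "'a::linordered_ab_group_add"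
  using nmult_less_iff [OF that, of b a] by (simp add: not_less [symmetric])

lemma nmult_eq_iff [simp]:
  "nmult n a = nmult n b \<longleftrightarrow> a = b" if "0 < n" for a b :: "'a::linordered_ab_group_add"
  using that by (simp add: order.eq_iff)

text \<open>A pair \<open>(a, n)\<close> with \<open>n > 0\<close> stands for the fraction \<open>a / n\<close>.\<close>

definition hullrel :: "'g::linordered_ab_group_add \<times> nat \<Rightarrow> 'g \<times> nat \<Rightarrow> bool"
  where "hullrel = (\<lambda>x y. 0 < snd x \<and> 0 < snd y \<and> nmult (snd y) (fst x) = nmult (snd x) (fst y))"

lemma hullrel_iff [simp]:
  "hullrel x y \<longleftrightarrow> 0 < snd x \<and> 0 < snd y \<and> nmult (snd y) (fst x) = nmult (snd x) (fst y)"
  by (simp add: hullrel_def)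

lemma part_equivp_hullrel: "part_equivp (hullrel :: 'g::linordered_ab_group_add \<times> nat \<Rightarrow> _)"
proof (rule part_equivpI)
  show "\<exists>x :: 'g \<times> nat. hullrel x x"
    by (auto intro: exI [of _ 1])
  show "symp (hullrel :: 'g \<times> nat \<Rightarrow> _)"
    by (auto simp: symp_def)
  show "transp (hullrel :: 'g \<times> nat \<Rightarrow> _)"
  proof (rule transpI, unfold split_paired_all)
    fix a b c :: 'g and k m n :: nat
    assume *: "hullrel (a, k) (b, m)" and **: "hullrel (b, m) (c, n)"
    have "nmult m (nmult n a) = nmult n (nmult m a)"
      by (rule nmult_commute)
    also have "\<dots> = nmult k (nmult n b)"
      using * by (simp add: nmult_commute)
    also have "\<dots> = nmult m (nmult k c)"
      using ** by (simp add: nmult_commute)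
    finally show "hullrel (a, k) (c, n)"
      using * ** by simp
  qed
qed

quotient_type (overloaded) 'g div_hull = "'g::linordered_ab_group_add \<times> nat" / partial: hullrel
  by (rule part_equivp_hullrel)

lemma Domainp_cr_div_hull [transfer_domain_rule]: "Domainp (pcr_div_hull (=)) = (\<lambda>x. 0 < snd x)"
  by (simp add: div_hull.domain_eq)

lemma hull_add_cong:
  fixes a a' b b' :: "'g::linordered_ab_group_add"
  assumes "nmult m' a = nmult m a'" "nmult n' b = nmult n b'"
  shows "nmult (m' * n') (nmult n a + nmult m b) = nmult (m * n) (nmult n' a' + nmult m' b')"
proof -
  have "nmult (m' * n') (nmult n a + nmult m b)
      = nmult (n' * n) (nmult m' a) + nmult (m' * m) (nmult n' b)"
    by (simp add: nmult_add nmult_nmult ac_simps)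
  also have "\<dots> = nmult (m * n) (nmult n' a' + nmult m' b')"
    by (simp add: assms nmult_add nmult_nmult ac_simps)
  finally show ?thesis .
qed

lemma hull_le_cong:
  fixes a a' b b' :: "'g::linordered_ab_group_add"
  assumes "0 < m" "0 < m'" "0 < n" "0 < n'" "nmult m' a = nmult m a'" "nmult n' b = nmult n b'"
  shows "nmult n a \<le> nmult m b \<longleftrightarrow> nmult n' a' \<le> nmult m' b'"
proof -
  have "nmult n a \<le> nmult m b
      \<longleftrightarrow> nmult (m' * n') (nmult n a) \<le> nmult (m' * n') (nmult m b)"
    using assms by simp
  also have "nmult (m' * n') (nmult n a) = nmult (n' * n) (nmult m' a)"
    by (simp add: nmult_nmult ac_simps)
  also have "\<dots> = nmult (m * n) (nmult n' a')"
    by (simp add: assms nmult_nmult ac_simps)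
  also have "nmult (m' * n') (nmult m b) = nmult (m' * m) (nmult n' b)"
    by (simp add: nmult_nmult ac_simps)
  also have "\<dots> = nmult (m * n) (nmult m' b')"
    by (simp add: assms nmult_nmult ac_simps)
  finally show ?thesis
    using assms by simp
qed

instantiation div_hull :: (linordered_ab_group_add) linordered_ab_group_add
begin

lift_definition zero_div_hull :: "'a div_hull" is "(0, 1)"
  by simp

lift_definition plus_div_hull :: "'a div_hull \<Rightarrow> 'a div_hull \<Rightarrow> 'a div_hull"
  is "\<lambda>x y. (nmult (snd y) (fst x) + nmult (snd x) (fst y), snd x * snd y)"
  by (simp add: hull_add_cong)

lift_definition uminus_div_hull :: "'a div_hull \<Rightarrow> 'a div_hull"
  is "\<lambda>x. (- fst x, snd x)"
  by (simp add: nmult_uminus)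

definition minus_div_hull :: "'a div_hull \<Rightarrow> 'a div_hull \<Rightarrow> 'a div_hull"
  where "x - y = x + - y" for x y :: "'a div_hull"

lift_definition less_eq_div_hull :: "'a div_hull \<Rightarrow> 'a div_hull \<Rightarrow> bool"
  is "\<lambda>x y. nmult (snd y) (fst x) \<le> nmult (snd x) (fst y)"
  by (rule hull_le_cong) simp_all

definition less_div_hull :: "'a div_hull \<Rightarrow> 'a div_hull \<Rightarrow> bool"
  where "x < y \<longleftrightarrow> x \<le> y \<and> \<not> y \<le> x" for x y :: "'a div_hull"

instance
proof
  fix x y z :: "'a div_hull"
  show "x + y + z = x + (y + z)"
    by transfer (simp add: nmult_add nmult_nmult ac_simps)
  show "x + y = y + x"
    by transfer (simp add: ac_simps)
  show "0 + x = x"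
    by transfer simp
  show "- x + x = 0"
    by transfer (simp add: nmult_uminus)
  show "x - y = x + - y"
    by (rule minus_div_hull_def)
  show "x < y \<longleftrightarrow> x \<le> y \<and> \<not> y \<le> x"
    by (rule less_div_hull_def)
  show "x \<le> x"
    by transfer simp
  show "x = y" if "x \<le> y" "y \<le> x"
    using that by transfer simp
  show "x \<le> y \<or> y \<le> x"
    by transfer auto
  show "x \<le> z" if "x \<le> y" "y \<le> z"
    using that
  proof (transfer, unfold split_paired_all, simp)
    fix a b c :: 'a and k m n :: nat
    assume pos: "0 < k" "0 < m" "0 < n"
      and *: "nmult m a \<le> nmult k b" and **: "nmult n b \<le> nmult m c"
    have "nmult m (nmult n a) = nmult n (nmult m a)"
      by (rule nmult_commute)
    also have "\<dots> \<le> nmult n (nmult k b)"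
      using * pos by simp
    also have "\<dots> = nmult k (nmult n b)"
      by (rule nmult_commute)
    also have "\<dots> \<le> nmult k (nmult m c)"
      using ** pos by simp
    also have "\<dots> = nmult m (nmult k c)"
      by (rule nmult_commute)
    finally show "nmult n a \<le> nmult k c"
      using pos by simp
  qed
  show "z + x \<le> z + y" if "x \<le> y"
    using that
  proof (transfer, unfold split_paired_all, simp)
    fix a b c :: 'a and k m n :: nat
    assume pos: "0 < k" "0 < m" "0 < n" and *: "nmult m a \<le> nmult k b"
    have "nmult (n * m) (nmult k c + nmult n a)
        = nmult (n * m * k) c + nmult (n * n) (nmult m a)"
      by (simp add: nmult_add nmult_nmult ac_simps)
    also have "\<dots> \<le> nmult (n * m * k) c + nmult (n * n) (nmult k b)"
      using * pos by simp
    also have "\<dots> = nmult (n * k) (nmult m c + nmult n b)"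
      by (simp add: nmult_add nmult_nmult ac_simps)
    finally show "nmult (n * m) (nmult k c + nmult n a) \<le> nmult (n * k) (nmult m c + nmult n b)" .
  qed
qed

end

instantiation div_hull :: (linordered_ab_group_add) linorder_topology
begin

definition open_div_hull :: "'a div_hull set \<Rightarrow> bool"
  where "open_div_hull =
    generate_topology (range (\<lambda>a::'a div_hull. {..<a}) \<union> range (\<lambda>a. {a<..}))"

instance
  by standard (rule open_div_hull_def)

end

lift_definition to_hull :: "'g::linordered_ab_group_add \<Rightarrow> 'g div_hull" is "\<lambda>a. (a, 1)"
  by simp

text \<open>
  The following facts characterise the divisible hull with its ordering: it is a divisible
  ordered group extending \<open>'g\<close>, and every element has a positive multiple in \<open>'g\<close>.
\<close>

lemma to_hull_add: "to_hull (a + b) = to_hull a + to_hull b"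
  by transfer simp

lemma to_hull_le_iff: "to_hull a \<le> to_hull b \<longleftrightarrow> a \<le> b"
  by transfer simp

lemma inj_to_hull: "inj to_hull"
  by (rule injI) (transfer, simp)

lemma nmult_div_hull_Abs:
  fixes a :: "'g::linordered_ab_group_add"
  assumes "0 < m"
  shows "nmult n (abs_div_hull (a, m)) = abs_div_hull (nmult n a, m)"
proof -
  have *: "abs_div_hull (b, m) + abs_div_hull (c, m) = abs_div_hull (b + c, m)" for b c :: 'g
  proof -
    have "abs_div_hull (b, m) + abs_div_hull (c, m) = abs_div_hull (nmult m b + nmult m c, m * m)"
      using assms by (simp add: plus_div_hull.abs_eq)
    also have "\<dots> = abs_div_hull (b + c, m)"
      using assms
      by (intro Quotient_rel_abs [OF Quotient_div_hull]) (simp add: nmult_add nmult_nmult)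
    finally show ?thesis .
  qed
  have "(0 :: 'g div_hull) = abs_div_hull (0, m)"
    unfolding zero_div_hull_def
    using assms by (intro Quotient_rel_abs [OF Quotient_div_hull]) simp
  then show ?thesis
    by (induction n) (simp_all add: *)
qed

lemma div_hull_cases:
  obtains a :: "'g::linordered_ab_group_add" and m where "0 < m" "x = abs_div_hull (a, m)"
  using Quotient_abs_rep [OF Quotient_div_hull, of x]
    Quotient_rep_reflp [OF Quotient_div_hull, of x]
  by (cases "rep_div_hull x") auto

lemma div_hull_divisible:
  assumes "0 < n"
  shows "\<exists>y. nmult n y = (x :: 'g::linordered_ab_group_add div_hull)"
proof -
  obtain a m where x: "0 < m" "x = abs_div_hull (a, m)"
    by (rule div_hull_cases)
  have "nmult n (abs_div_hull (a, n * m)) = abs_div_hull (nmult n a, n * m)"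
    using x assms by (intro nmult_div_hull_Abs) simp
  also have "\<dots> = x"
    unfolding x(2) using x(1) assms
    by (intro Quotient_rel_abs [OF Quotient_div_hull]) (simp add: nmult_nmult ac_simps)
  finally show ?thesis ..
qed

lemma div_hull_torsion_over: "\<exists>n>0. nmult n x \<in> range to_hull"
proof -
  obtain a m where x: "0 < m" "x = abs_div_hull (a, m)"
    by (rule div_hull_cases)
  have "nmult m x = abs_div_hull (nmult m a, m)"
    using x by (simp add: nmult_div_hull_Abs)
  also have "\<dots> = to_hull a"
    unfolding to_hull_def using x
    by (auto intro: Quotient_rel_abs [OF Quotient_div_hull])
  finally show ?thesis
    using x by auto
qed


section \<open>First-order formulas in the language of rings\<close>

datatype ring_term =
  RVar nat | RZero | ROne | RAdd ring_term ring_term | RNeg ring_term | RMul ring_term ring_term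

datatype ring_formula =
  REq ring_term ring_term
| RFalse
| RImp ring_formula ring_formula
| RAll nat ring_formula

primrec eval_term :: "(nat \<Rightarrow> 'k::comm_ring_1) \<Rightarrow> ring_term \<Rightarrow> 'k"
  where
    "eval_term e (RVar i) = e i"
  | "eval_term e RZero = 0"
  | "eval_term e ROne = 1"
  | "eval_term e (RAdd s t) = eval_term e s + eval_term e t"
  | "eval_term e (RNeg t) = - eval_term e t"
  | "eval_term e (RMul s t) = eval_term e s * eval_term e t"

primrec sat :: "(nat \<Rightarrow> 'k::comm_ring_1) \<Rightarrow> ring_formula \<Rightarrow> bool"
  where
    "sat e (REq s t) \<longleftrightarrow> eval_term e s = eval_term e t"
  | "sat e RFalse \<longleftrightarrow> False"
  | "sat e (RImp p q) \<longleftrightarrow> (sat e p \<longrightarrow> sat e q)"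
  | "sat e (RAll i p) \<longleftrightarrow> (\<forall>a. sat (e(i := a)) p)"

primrec term_vars :: "ring_term \<Rightarrow> nat set"
  where
    "term_vars (RVar i) = {i}"
  | "term_vars RZero = {}"
  | "term_vars ROne = {}"
  | "term_vars (RAdd s t) = term_vars s \<union> term_vars t"
  | "term_vars (RNeg t) = term_vars t"
  | "term_vars (RMul s t) = term_vars s \<union> term_vars t"

primrec free_vars :: "ring_formula \<Rightarrow> nat set"
  where
    "free_vars (REq s t) = term_vars s \<union> term_vars t"
  | "free_vars RFalse = {}"
  | "free_vars (RImp p q) = free_vars p \<union> free_vars q"
  | "free_vars (RAll i p) = free_vars p - {i}"

lemma eval_term_cong: "eval_term e t = eval_term e' t" if "\<And>i. i \<in> term_vars t \<Longrightarrow> e i = e' i"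
  using that by (induction t) simp_all

lemma sat_cong: "sat e p \<longleftrightarrow> sat e' p" if "\<And>i. i \<in> free_vars p \<Longrightarrow> e i = e' i"
  using that
proof (induction p arbitrary: e e')
  case (REq s t)
  have "eval_term e s = eval_term e' s" "eval_term e t = eval_term e' t"
    by (rule eval_term_cong, simp add: REq)+
  then show ?case
    by simp
next
  case RFalse
  show ?case
    by simp
next
  case (RImp p q)
  have "sat e p \<longleftrightarrow> sat e' p"
    by (rule RImp.IH(1)) (simp add: RImp.prems)
  moreover have "sat e q \<longleftrightarrow> sat e' q"
    by (rule RImp.IH(2)) (simp add: RImp.prems)
  ultimately show ?case
    by simp
next
  case (RAll i p)
  have "sat (e(i := a)) p \<longleftrightarrow> sat (e'(i := a)) p" for a
    by (rule RAll.IH) (simp add: RAll.prems)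
  then show ?case
    by simp
qed

text \<open>
  \<open>sat2 a c \<phi>\<close> is truth of \<open>\<phi>(a, c)\<close>: variable 0 is \<open>x\<close> and variable 1 is \<open>y\<close>. It is meant for
  formulas with \<open>free_vars \<phi> \<subseteq> {0, 1}\<close>; by \<open>sat_cong\<close> the other variables are then irrelevant.
\<close>

definition sat2 :: "'k::comm_ring_1 \<Rightarrow> 'k \<Rightarrow> ring_formula \<Rightarrow> bool"
  where "sat2 a c \<phi> \<longleftrightarrow> sat (\<lambda>i. if i = 0 then a else c) \<phi>"

end

(*
  Let alpha be a limit point of the value group G in its divisible hull with alpha not in G,
  say n * alpha = gamma with gamma in G, and let v(c) = -gamma. The equation
  y^n + y = c z^n is solvable iff v(z) > alpha: since gamma is not in nG, the value of c z^n is
  never 0; if it is positive, the residue of Y^n + Y - c z^n has the simple zero 0 and Hensel's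
  Lemma applies in every residue characteristic; if it is negative, a solution y would have
  n * v(y) = v(c z^n), which is impossible. Because G accumulates at alpha, the
  valuation ring consists of those a for which v(z) > alpha implies v(a z) > alpha.
*)

theory Submission
  imports Defs
begin

section \<open>Limit points of an ordered group in its divisible hull\<close>

lemma nmult_less_self:
  fixes u :: "'g::linordered_ab_group_add"
  assumes "2 \<le> n" "u < 0"
  shows "nmult n u < u"
proof -
  obtain m where m: "n = Suc m" "0 < m"
    using assms(1) by (cases n) auto
  then have "nmult m u < 0"
    using nmult_strict_mono [OF assms(2) m(2)] by simp
  then show ?thesis
    using m by simp
qed

lemma to_hull_less_iff: "to_hull a < to_hull b \<longleftrightarrow> a < b"
  using to_hull_le_iff [of b a] by (simp add: not_le [symmetric])

lemma to_hull_zero: "to_hull 0 = 0"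
  using to_hull_add [of 0 0] by simp

lemma to_hull_nmult: "to_hull (nmult n a) = nmult n (to_hull a)"
  by (induction n) (simp_all add: to_hull_zero to_hull_add)

text \<open>An approximating \<open>g\<close> may lie on the wrong side of \<open>\<alpha>\<close>.
  Then \<open>\<alpha> - \<epsilon> < g < \<alpha>\<close>, and the translate
  \<open>g + \<epsilon>\<close> lies in the required interval above \<open>\<alpha>\<close>.\<close>

lemma limit_point_above:
  fixes \<alpha> :: "'g::linordered_ab_group_add div_hull"
  assumes "\<And>T. open T \<Longrightarrow> \<alpha> \<in> T \<Longrightarrow> T \<inter> range to_hull \<noteq> {}" "\<alpha> \<notin> range to_hull" "0 < \<epsilon>"
  obtains g where "\<alpha> < to_hull g" "to_hull g < \<alpha> + to_hull \<epsilon>"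
proof -
  have \<epsilon>: "0 < to_hull \<epsilon>"
    using assms(3) by (metis to_hull_less_iff to_hull_zero)
  have "{\<alpha> - to_hull \<epsilon> <..< \<alpha> + to_hull \<epsilon>} \<inter> range to_hull \<noteq> {}"
    using \<epsilon> by (intro assms(1)) auto
  then obtain g where g: "\<alpha> - to_hull \<epsilon> < to_hull g" "to_hull g < \<alpha> + to_hull \<epsilon>"
    by auto
  show thesis
  proof (cases "\<alpha> < to_hull g")
    case True
    then show thesis
      using g(2) by (rule that)
  next
    case False
    moreover have "to_hull g \<noteq> \<alpha>"
      using assms(2) by blast
    ultimately have "to_hull g < \<alpha>"
      by simp
    then have "\<alpha> < to_hull (g + \<epsilon>)" "to_hull (g + \<epsilon>) < \<alpha> + to_hull \<epsilon>"
      using g(1) by (simp_all add: to_hull_add diff_less_eq)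
    then show thesis
      by (rule that)
  qed
qed

text \<open>Removes the hull from the argument: with \<open>\<alpha> = \<gamma> / n\<close>, the
  second property says that \<open>\<alpha>\<close> is not in the group, and the third that some
  group element \<open>g\<close> satisfies
  \<open>\<alpha> < g < \<alpha> + \<epsilon>\<close>.\<close>

lemma not_closed_in_hullE:
  assumes "\<not> closed (range (to_hull :: 'g::linordered_ab_group_add \<Rightarrow> 'g div_hull))"
  obtains n and \<gamma> :: "'g::linordered_ab_group_add"
    where "2 \<le> n" "\<And>g. nmult n g \<noteq> \<gamma>"
    "\<And>\<epsilon>. 0 < \<epsilon> \<Longrightarrow> \<exists>g. \<gamma> < nmult n g \<and> nmult n (g - \<epsilon>) < \<gamma>"
proof -
  have "\<not> open (- range (to_hull :: 'g \<Rightarrow> 'g div_hull))"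
    using assms by (simp add: closed_def)
  \<comment> \<open>Applied to the complement of the group, this criterion must fail at some point;
    that point is \<open>\<alpha>\<close>.\<close>
  moreover have "open S"
    if "\<And>x. x \<in> S \<Longrightarrow> \<exists>T. open T \<and> x \<in> T \<and> T \<subseteq> S" for S :: "'g div_hull set"
    using that by (rule openI)
  ultimately obtain \<alpha> :: "'g div_hull" where \<alpha>: "\<alpha> \<notin> range to_hull"
    and lim: "\<And>T. open T \<Longrightarrow> \<alpha> \<in> T \<Longrightarrow> T \<inter> range to_hull \<noteq> {}"
    by (metis ComplD disjoint_eq_subset_Compl)
  obtain n \<gamma> where n: "0 < n" and \<gamma>: "nmult n \<alpha> = to_hull \<gamma>"
    using div_hull_torsion_over [of \<alpha>] by auto
  have notin: "nmult n g \<noteq> \<gamma>" for g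
  proof
    assume "nmult n g = \<gamma>"
    then have "nmult n (to_hull g) = nmult n \<alpha>"
      using \<gamma> by (simp add: to_hull_nmult [symmetric])
    then show False
      using n \<alpha> by auto
  qed
  \<comment> \<open>For \<open>n = 1\<close>, \<open>\<gamma>\<close> would be its own
    \<open>n\<close>-th part.\<close>
  have "n \<noteq> 1"
    using notin [of \<gamma>] by auto
  then have "2 \<le> n"
    using n by simp
  moreover have "\<exists>g. \<gamma> < nmult n g \<and> nmult n (g - \<epsilon>) < \<gamma>" if \<epsilon>: "0 < \<epsilon>" for \<epsilon>
  proof -
    obtain g where g: "\<alpha> < to_hull g" "to_hull g < \<alpha> + to_hull \<epsilon>"
      using limit_point_above [OF lim \<alpha> \<epsilon>] by blast
    have "to_hull (g - \<epsilon>) + to_hull \<epsilon> = to_hull g"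
      by (simp add: to_hull_add [symmetric])
    then have "to_hull (g - \<epsilon>) < \<alpha>"
      using g(2) by (metis add_less_cancel_right)
    then have "nmult n (to_hull (g - \<epsilon>)) < nmult n \<alpha>" "nmult n \<alpha> < nmult n (to_hull g)"
      using g(1) n by simp_all
    then show ?thesis
      unfolding \<gamma> to_hull_nmult [symmetric] to_hull_less_iff by blast
  qed
  ultimately show thesis
    using notin that by blast
qed


section \<open>Valuations\<close>

context valued_field
begin

lemma v_zero [simp]: "v 0 = Pinf"
  by (simp add: v_eq_Pinf_iff)

lemma v_cases:
  obtains "x = 0" | u where "x \<noteq> 0" "v x = Fin u"
proof -
  have "v x \<in> insert Pinf (range Fin)"
    using range_v by blast
  then show thesis
    using that v_eq_Pinf_iff [of x] by auto
qed

lemma v_surj: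
  obtains x where "v x = Fin u"
proof -
  have "Fin u \<in> range v"
    using range_v by blast
  then show thesis
    using that by (metis rangeE)
qed

lemma v_one [simp]: "v 1 = Fin 0"
  using v_mult [of 1 1] by (cases "1 :: 'k" rule: v_cases) auto

lemma v_minus [simp]: "v (- x) = v x"
proof -
  obtain u where u: "v (- 1) = Fin u"
    by (cases "- 1 :: 'k" rule: v_cases) auto
  \<comment> \<open>The square of \<open>- 1\<close> is 1, and an ordered group has no
    torsion.\<close>
  have "Fin (u + u) = Fin 0"
    using v_mult [of "- 1" "- 1"] u by simp
  then have "u = 0"
    by simp
  then show ?thesis
    using v_mult [of "- 1" x] u by (cases x rule: v_cases) auto
qed

lemma v_power:
  assumes "v x = Fin u"
  shows "v (x ^ n) = Fin (nmult n u)"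
  using assms by (induction n) (simp_all add: v_mult)

lemma v_add_ge: "a \<le> v x \<Longrightarrow> a \<le> v y \<Longrightarrow> a \<le> v (x + y)"
  using v_add [of x y] by (meson min.boundedI order.trans)

lemma v_add_eq:
  assumes "v x < v y"
  shows "v (x + y) = v x"
proof (rule antisym)
  show "v x \<le> v (x + y)"
    using assms by (intro v_add_ge) simp_all
  \<comment> \<open>Write \<open>x\<close> as \<open>(x + y) - y\<close>. As \<open>v y\<close>
    exceeds \<open>v x\<close>, the minimum can only be \<open>v (x + y)\<close>.\<close>
  have "min (v (x + y)) (v y) \<le> v x"
    using v_add [of "x + y" "- y"] by simp
  then show "v (x + y) \<le> v x"
    using assms by (auto simp: min_le_iff_disj)
qed

end


section \<open>The equation \<open>y\<^sup>n + y = s\<close>\<close>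

lemma (in henselian_valued_field) power_add_self_solvable:
  assumes "2 \<le> n" "0 < v s"
  shows "\<exists>y. y ^ n + y = s"
proof -
  define f where "f = monom 1 n + [:- s, 1:]"
  have "0 \<le> v (coeff f i)" for i
    using assms(2) unfolding f_def coeff_add
    by (intro v_add_ge) (auto simp: zero_extended_def coeff_pCons split: nat.split)
  \<comment> \<open>Since \<open>n \<ge> 2\<close>, the power contributes nothing to the derivative
    at 0, whatever the characteristic.\<close>
  moreover have "poly f 0 = - s" "poly (pderiv f) 0 = 1"
    using assms(1) by (simp_all add: f_def poly_monom pderiv_add pderiv_monom pderiv_pCons)
  ultimately obtain y where "poly f y = 0"
    using hensel [of f 0] assms(2) by (auto simp: valuation_ring_def zero_extended_def)
  then have "y ^ n + y = s"
    by (simp add: f_def poly_monom algebra_simps)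
  then show ?thesis ..
qed

text \<open>A negative value of the sum forces \<open>v y < 0\<close>; then \<open>y ^ n\<close> has
  strictly smaller value than \<open>y\<close> and determines the value of the sum.\<close>

lemma (in valued_field) v_power_add_self:
  assumes "2 \<le> n" "v (y ^ n + y) < 0"
  shows "\<exists>u. v (y ^ n + y) = Fin (nmult n u)"
proof (cases y rule: v_cases)
  case 1
  then show ?thesis
    using assms by (simp add: zero_extended_def zero_power)
next
  case (2 u)
  have n: "0 < n"
    using assms(1) by simp
  have "u < 0"
  proof (rule ccontr)
    assume "\<not> u < 0"
    then have "0 \<le> nmult n u"
      using nmult_le_iff [OF n, of 0 u] by simp
    then have "0 \<le> v (y ^ n + y)"
      using \<open>\<not> u < 0\<close> 2 by (intro v_add_ge) (simp_all add: v_power zero_extended_def)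
    then show False
      using assms(2) by simp
  qed
  then have "v (y ^ n) < v y"
    using nmult_less_self [OF assms(1)] 2 by (simp add: v_power)
  then show ?thesis
    using v_add_eq v_power [OF 2(2)] by metis
qed

text \<open>The right-hand side expresses \<open>v z > \<gamma> / n\<close> without division, with
  \<open>z = 0\<close> having infinite value.\<close>

lemma (in henselian_valued_field) power_add_self_solvable_iff:
  assumes "2 \<le> n" "\<And>g. nmult n g \<noteq> \<gamma>" "v c = Fin (- \<gamma>)"
  shows "(\<exists>y. y ^ n + y = c * z ^ n) \<longleftrightarrow> z = 0 \<or> (\<exists>g. v z = Fin g \<and> \<gamma> < nmult n g)"
proof (cases z rule: v_cases)
  case 1
  then have "0 ^ n + 0 = c * z ^ n"
    using assms(1) by simp
  then show ?thesis
    using 1 by blast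
next
  case (2 g)
  have s: "v (c * z ^ n) = Fin (nmult n g - \<gamma>)"
    using 2 assms(3) by (simp add: v_mult v_power)
  have "(\<exists>y. y ^ n + y = c * z ^ n) \<longleftrightarrow> \<gamma> < nmult n g"
  proof
    assume "\<gamma> < nmult n g"
    then show "\<exists>y. y ^ n + y = c * z ^ n"
      by (intro power_add_self_solvable assms(1)) (simp add: s zero_extended_def)
  next
    assume "\<exists>y. y ^ n + y = c * z ^ n"
    then obtain y where y: "y ^ n + y = c * z ^ n" ..
    show "\<gamma> < nmult n g"
    proof (rule ccontr)
      assume "\<not> \<gamma> < nmult n g"
      then have "nmult n g < \<gamma>"
        using assms(2) [of g] by simp
      then have "v (y ^ n + y) < 0"
        by (simp add: y s zero_extended_def)
      \<comment> \<open>A solution would make the value of \<open>c * z ^ n\<close> divisible by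
        \<open>n\<close>, and hence \<open>\<gamma>\<close> too.\<close>
      from v_power_add_self [OF assms(1) this] obtain u where "nmult n g - \<gamma> = nmult n u"
        by (auto simp: y s)
      then have "nmult n (g - u) = \<gamma>"
        using nmult_add [of n g "- u"] by (simp add: nmult_uminus algebra_simps)
      then show False
        using assms(2) by blast
    qed
  qed
  then show ?thesis
    using 2 by simp
qed

text \<open>Multiplication by an integral \<open>a\<close> does not lower values, so it preserves
  the cut \<open>v z > \<gamma> / n\<close>. If \<open>v a < 0\<close>, some \<open>z\<close> lies
  so close above the cut that \<open>a * z\<close> falls below it.\<close>

lemma (in henselian_valued_field) valuation_ring_eq:
  assumes "2 \<le> n" "\<And>g. nmult n g \<noteq> \<gamma>" "v c = Fin (- \<gamma>)"
    and lim: "\<And>\<epsilon>. 0 < \<epsilon> \<Longrightarrow> \<exists>g. \<gamma> < nmult n g \<and> nmult n (g - \<epsilon>) < \<gamma>"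
  shows "valuation_ring v
    = {a. \<forall>z. (\<exists>y. y ^ n + y = c * z ^ n) \<longrightarrow> (\<exists>y. y ^ n + y = c * (a * z) ^ n)}"
  unfolding power_add_self_solvable_iff [OF assms(1-3)]
proof (intro equalityI subsetI CollectI allI impI)
  fix a z
  assume a: "a \<in> valuation_ring v" and z: "z = 0 \<or> (\<exists>g. v z = Fin g \<and> \<gamma> < nmult n g)"
  show "a * z = 0 \<or> (\<exists>g. v (a * z) = Fin g \<and> \<gamma> < nmult n g)"
  proof (cases "a * z = 0")
    case False
    then obtain g u where g: "v z = Fin g" "\<gamma> < nmult n g" and u: "v a = Fin u"
      using z by (cases a rule: v_cases) auto
    have "0 \<le> u"
      using a u by (simp add: valuation_ring_def zero_extended_def)
    then have "nmult n g \<le> nmult n (u + g)"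
      using assms(1) by simp
    then show ?thesis
      using g u by (auto simp: v_mult)
  qed simp
next
  fix a
  assume a: "a \<in> {a. \<forall>z. z = 0 \<or> (\<exists>g. v z = Fin g \<and> \<gamma> < nmult n g) \<longrightarrow>
      a * z = 0 \<or> (\<exists>g. v (a * z) = Fin g \<and> \<gamma> < nmult n g)}"
  show "a \<in> valuation_ring v"
  proof (rule ccontr)
    assume *: "a \<notin> valuation_ring v"
    then obtain u where u: "a \<noteq> 0" "v a = Fin u" "u < 0"
      by (cases a rule: v_cases) (auto simp: valuation_ring_def zero_extended_def)
    \<comment> \<open>The distance \<open>- u\<close> is exactly how far multiplication by
      \<open>a\<close> shifts values down.\<close>
    then obtain g where g: "\<gamma> < nmult n g" "nmult n (g - - u) < \<gamma>"
      using lim [of "- u"] by auto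
    obtain z where z: "v z = Fin g"
      by (rule v_surj)
    have "z \<noteq> 0"
      using z by auto
    moreover have "v (a * z) = Fin (g - - u)"
      using u z by (simp add: v_mult add.commute)
    ultimately show False
      using a g z u(1) by force
  qed
qed


section \<open>The defining formula\<close>

primrec RPow :: "ring_term \<Rightarrow> nat \<Rightarrow> ring_term"
  where
    "RPow t 0 = ROne"
  | "RPow t (Suc n) = RMul t (RPow t n)"

lemma eval_term_RPow [simp]: "eval_term e (RPow t n) = eval_term e t ^ n"
  by (induction n) simp_all

lemma term_vars_RPow: "term_vars (RPow t n) \<subseteq> term_vars t"
  by (induction n) auto

definition REx :: "nat \<Rightarrow> ring_formula \<Rightarrow> ring_formula"
  where "REx i p = RImp (RAll i (RImp p RFalse)) RFalse"

lemma sat_REx [simp]: "sat e (REx i p) \<longleftrightarrow> (\<exists>a. sat (e(i := a)) p)"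
  by (simp add: REx_def)

lemma free_vars_REx [simp]: "free_vars (REx i p) = free_vars p - {i}"
  by (simp add: REx_def)

text \<open>Variable 3 is bound here and must not occur in \<open>t\<close>.\<close>

definition solvable_formula :: "nat \<Rightarrow> ring_term \<Rightarrow> ring_formula"
  where "solvable_formula n t =
    REx 3 (REq (RAdd (RPow (RVar 3) n) (RVar 3)) (RMul (RVar 1) (RPow t n)))"

lemma free_vars_solvable_formula: "free_vars (solvable_formula n t) \<subseteq> insert 1 (term_vars t)"
  using term_vars_RPow [of "RVar 3" n] term_vars_RPow [of t n]
  by (auto simp: solvable_formula_def)

lemma sat_solvable_formula:
  assumes "3 \<notin> term_vars t"
  shows "sat e (solvable_formula n t) \<longleftrightarrow> (\<exists>y. y ^ n + y = e 1 * eval_term e t ^ n)"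
proof -
  have "eval_term (e(3 := y)) t = eval_term e t" for y
    using assms by (intro eval_term_cong) auto
  then show ?thesis
    by (simp add: solvable_formula_def)
qed

text \<open>Variable 0 is the element tested, variable 1 the parameter \<open>c\<close>, and
  variable 2 the quantified \<open>z\<close>.\<close>

definition valuation_ring_formula :: "nat \<Rightarrow> ring_formula"
  where "valuation_ring_formula n =
    RAll 2 (RImp (solvable_formula n (RVar 2)) (solvable_formula n (RMul (RVar 0) (RVar 2))))"

lemma free_vars_valuation_ring_formula: "free_vars (valuation_ring_formula n) \<subseteq> {0, 1}"
  using free_vars_solvable_formula [of n "RVar 2"]
    free_vars_solvable_formula [of n "RMul (RVar 0) (RVar 2)"]
  by (auto simp: valuation_ring_formula_def)

lemma sat2_valuation_ring_formula:
  "sat2 a c (valuation_ring_formula n) \<longleftrightarrow>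
    (\<forall>z. (\<exists>y. y ^ n + y = c * z ^ n) \<longrightarrow> (\<exists>y. y ^ n + y = c * (a * z) ^ n))"
  by (simp add: sat2_def valuation_ring_formula_def sat_solvable_formula)

theorem theorem1:
  fixes v :: "'k::field \<Rightarrow> 'g::linordered_ab_group_add extended"
  assumes "henselian_valued_field v"
    and "\<not> closed (range (to_hull :: 'g \<Rightarrow> 'g div_hull))"
  shows "\<exists>\<phi> c. free_vars \<phi> \<subseteq> {0, 1} \<and> valuation_ring v = {a. sat2 a c \<phi>}"
proof -
  interpret henselian_valued_field v
    by (rule assms(1))
  obtain n and \<gamma> :: 'g where n: "2 \<le> n" "\<And>g. nmult n g \<noteq> \<gamma>"
    "\<And>\<epsilon>. 0 < \<epsilon> \<Longrightarrow> \<exists>g. \<gamma> < nmult n g \<and> nmult n (g - \<epsilon>) < \<gamma>"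
    using not_closed_in_hullE [OF assms(2)] by metis
  \<comment> \<open>This choice gives \<open>c * z ^ n\<close> positive value exactly when
    \<open>v z > \<gamma> / n\<close>.\<close>
  obtain c where c: "v c = Fin (- \<gamma>)"
    by (rule v_surj)
  have "valuation_ring v = {a. sat2 a c (valuation_ring_formula n)}"
    unfolding sat2_valuation_ring_formula by (rule valuation_ring_eq [OF n(1,2) c n(3)])
  then show ?thesis
    using free_vars_valuation_ring_formula by blast
qed

end
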